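(* If there are $\ell$ matrices $M_1, \dots, M_\ell$ of order $k$ with the following properties: (1) the rows of each $M_i$ are orthogonal, and (2) for $i \neq j$, all the entries of $M_i^T M_j$ are nonzero, then the graph $$G = \bigvee_{j=1}^{\ell} \Big( \bigcup_{i=1}^{k} K_{a_{i,j}} \Big)$$ has multiplicity bipartition $[n-k, k]$, provided all $a_{i,j} \geq 1$.
   Context: Matrices are real, a matrix of order $k$ is a $k\times k$ matrix, and the $a_{i,j}$ ($1\le i\le k$, $1\le j\le \ell$) are integers. All graphs are finite and simple, and $n$ denotes the number of vertices of $G$. $\mathcal{S}(G)$ is the set of real symmetric $n\times n$ matrices (indexed by the vertices of $G$) such that for distinct vertices $u,v$ the $(u,v)$ entry is nonzero if and only if $uv$ is an edge of $G$; the diagonal entries are arbitrary. $G$ has (that is, achieves) multiplicity bipartition $[n-k,k]$ if some $A\in\mathcal{S}(G)$ has exactly two distinct eigenvalues, with multiplicities $n-k$ and $k$. $\bigvee$ denotes the join of graphs (disjoint union plus all edges between different factors), $\bigcup$ denotes disjoint union, and $K_a$ is the complete graph on $a$ vertices. *)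

theory Defs
  imports "Jordan_Normal_Form.Char_Poly" "Graph_Theory.Pair_Digraph"
begin

text \<open>
  A finite simple graph is represented as a \<^locale>\<open>pair_graph\<close>: a finite, loop-free, symmetric
  digraph without parallel arcs, an edge \<open>uv\<close> being the two arcs \<open>(u, v)\<close> and \<open>(v, u)\<close>.
\<close>

definition complete_graph :: "nat \<Rightarrow> nat pair_pre_digraph" where
  "complete_graph a =
     \<lparr> pverts = {..<a}, parcs = {(u, v). u < a \<and> v < a \<and> u \<noteq> v} \<rparr>"

text \<open>
  In unions and joins of an indexed family, vertices are tagged with the index of their factor, so
  that the factors become disjoint.
\<close>

definition disjoint_union :: "'i set \<Rightarrow> ('i \<Rightarrow> 'a pair_pre_digraph) \<Rightarrow> ('i \<times> 'a) pair_pre_digraph"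
  where
  "disjoint_union I G =
     \<lparr> pverts = (SIGMA i:I. pverts (G i)),
       parcs = {((i, u), (i, v)) | i u v. i \<in> I \<and> (u, v) \<in> parcs (G i)} \<rparr>"

definition graph_join :: "'i set \<Rightarrow> ('i \<Rightarrow> 'a pair_pre_digraph) \<Rightarrow> ('i \<times> 'a) pair_pre_digraph"
  where
  "graph_join I G =
     \<lparr> pverts = pverts (disjoint_union I G),
       parcs = parcs (disjoint_union I G) \<union>
         {((i, u), (j, v)) | i j u v.
            i \<in> I \<and> j \<in> I \<and> i \<noteq> j \<and> u \<in> pverts (G i) \<and> v \<in> pverts (G j)} \<rparr>"

text \<open>
  The matrices of \<open>\<S>(G)\<close>. Since the library's matrices are indexed by \<open>0, \<dots>, n - 1\<close>,
  the vertices are numbered by a bijection \<open>f\<close>. Allowing every numbering only closes the set under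
  simultaneous permutations of rows and columns, which do not affect eigenvalues or multiplicities.
\<close>

definition graph_matrices :: "'a pair_pre_digraph \<Rightarrow> real mat set" where
  "graph_matrices G =
     {A. \<exists>f. bij_betw f {..<card (pverts G)} (pverts G) \<and>
         A \<in> carrier_mat (card (pverts G)) (card (pverts G)) \<and>
         transpose_mat A = A \<and>
         (\<forall>i < card (pverts G). \<forall>j < card (pverts G). i \<noteq> j \<longrightarrow>
            (A $$ (i, j) \<noteq> 0 \<longleftrightarrow> (f i, f j) \<in> parcs G))}"

text \<open>
  Multiplicities are algebraic; for these symmetric matrices they agree with the dimensions of the
  eigenspaces.
\<close>

definition has_multiplicity_bipartition :: "'a pair_pre_digraph \<Rightarrow> nat \<Rightarrow> nat \<Rightarrow> bool" where
  "has_multiplicity_bipartition G p q \<longleftrightarrow>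
     (\<exists>A \<in> graph_matrices G. \<exists>x y. x \<noteq> y \<and> {z. eigenvalue A z} = {x, y} \<and>
        order x (char_poly A) = p \<and> order y (char_poly A) = q)"

text \<open>Orthogonality is pairwise; neither unit length nor nonvanishing of the rows is implied.\<close>

definition rows_orthogonal :: "real mat \<Rightarrow> bool" where
  "rows_orthogonal A \<longleftrightarrow>
     (\<forall>i < dim_row A. \<forall>j < dim_row A. i \<noteq> j \<longrightarrow> row A i \<bullet> row A j = 0)"

lemma pair_graphI:
  assumes "finite (pverts G)" and "parcs G \<subseteq> pverts G \<times> pverts G"
    and "sym (parcs G)" and "irrefl (parcs G)"
  shows "pair_graph G"
proof
  show "finite (parcs G)"
    using assms(1,2) by (meson finite_SigmaI finite_subset)
  show "symmetric (with_proj G)"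
    using assms(3) by (simp add: symmetric_def)
  show "fst e \<noteq> snd e" if "e \<in> parcs G" for e
    using assms(4) that by (cases e) (auto simp: irrefl_def)
qed (use assms(1,2) in auto)

lemma pair_graphD:
  assumes "pair_graph G"
  shows "finite (pverts G)" and "parcs G \<subseteq> pverts G \<times> pverts G"
    and "sym (parcs G)" and "irrefl (parcs G)"
proof -
  interpret pair_graph G by fact
  show "finite (pverts G)" by (rule pair_finite_verts)
  show "parcs G \<subseteq> pverts G \<times> pverts G"
    using wellformed' by auto
  show "sym (parcs G)"
    using pair_sym_arcs by (simp add: symmetric_def)
  show "irrefl (parcs G)"
    using pair_no_loops by (fastforce simp: irrefl_def)
qed

lemma pair_graph_complete_graph: "pair_graph (complete_graph a)"
  by (rule pair_graphI) (auto simp: complete_graph_def sym_def irrefl_def)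

lemma pair_graph_disjoint_union:
  assumes "finite I" and "\<And>i. i \<in> I \<Longrightarrow> pair_graph (G i)"
  shows "pair_graph (disjoint_union I G)"
proof (rule pair_graphI)
  show "finite (pverts (disjoint_union I G))"
    using assms pair_graphD(1) by (auto simp: disjoint_union_def)
  show "parcs (disjoint_union I G) \<subseteq>
      pverts (disjoint_union I G) \<times> pverts (disjoint_union I G)"
    using pair_graphD(2)[OF assms(2)] by (fastforce simp: disjoint_union_def)
  show "sym (parcs (disjoint_union I G))"
    using pair_graphD(3)[OF assms(2)] by (auto simp: disjoint_union_def sym_def)
  show "irrefl (parcs (disjoint_union I G))"
    using pair_graphD(4)[OF assms(2)] by (auto simp: disjoint_union_def irrefl_def)
qed

lemma pair_graph_graph_join:
  assumes "finite I" and "\<And>i. i \<in> I \<Longrightarrow> pair_graph (G i)"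
  shows "pair_graph (graph_join I G)"
proof (rule pair_graphI)
  note D = pair_graphD[OF pair_graph_disjoint_union[OF assms]]
  show "finite (pverts (graph_join I G))"
    using D(1) by (simp add: graph_join_def)
  show "parcs (graph_join I G) \<subseteq> pverts (graph_join I G) \<times> pverts (graph_join I G)"
    using D(2) by (auto simp: graph_join_def) (auto simp: disjoint_union_def)
  show "sym (parcs (graph_join I G))"
    using D(3) by (auto simp: graph_join_def sym_def)
  show "irrefl (parcs (graph_join I G))"
    using D(4) by (auto simp: graph_join_def irrefl_def)
qed

end

theory Submission
  imports Defs
begin

text \<open>
  A graph whose vertices carry vectors \<open>w p \<in> \<real>\<^sup>k\<close>, nonorthogonal exactly along the edges, and
  such that the \<open>k\<close> coordinate functions are orthogonal and of equal norm on the vertex set, has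
  multiplicity bipartition \<open>[n - k, k]\<close>: the Gram matrix \<open>U U\<^sup>T\<close> has the nonzero eigenvalues of
  \<open>U\<^sup>T U\<close>, a scalar matrix. To the vertices of the clique \<open>i\<close> in the factor \<open>j\<close> we attach the
  \<open>i\<close>-th column of an orthogonal matrix \<open>H\<^sub>j\<close>, divided by the square root of the size of the
  clique. The edges between the factors require all entries of \<open>H\<^sub>i\<^sup>T H\<^sub>j\<close> to be nonzero. Normalising
  the rows of the \<open>M\<^sub>j\<close> could destroy condition (2), so we take for \<open>H\<^sub>j\<close> the Householder
  reflection along \<open>(1, x, \<dots>, x)\<close> with \<open>x = x\<^sub>j\<close>: distinct values of \<open>x\<close> make the off-diagonal
  entries nonzero, and close ones the diagonal entries.
\<close>

subsection \<open>Characteristic polynomials of products\<close>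

lemma char_poly_four_block_upper_right_zero:
  fixes A :: "'a :: idom mat"
  assumes A: "A \<in> carrier_mat n n" and C: "C \<in> carrier_mat m n" and D: "D \<in> carrier_mat m m"
  shows "char_poly (four_block_mat A (0\<^sub>m n m) C D) = char_poly A * char_poly D"
proof -
  have "char_poly_matrix (four_block_mat A (0\<^sub>m n m) C D) =
      four_block_mat (char_poly_matrix A) (0\<^sub>m n m) (map_mat (\<lambda>a. [:- a:]) C) (char_poly_matrix D)"
    by (rule eq_matI) (use assms in \<open>auto simp: char_poly_matrix_def one_poly_def\<close>)
  then show ?thesis
    using assms det_four_block_mat_upper_right_zero[of "char_poly_matrix A" n "0\<^sub>m n m" m
        "map_mat (\<lambda>a. [:- a:]) C" "char_poly_matrix D"]
    by (simp add: char_poly_def)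
qed

lemma char_poly_smult_one_mat: "char_poly (c \<cdot>\<^sub>m 1\<^sub>m n :: 'a :: comm_ring_1 mat) = [:- c, 1:] ^ n"
proof -
  have "map (\<lambda>i. (c \<cdot>\<^sub>m 1\<^sub>m n :: 'a mat) $$ (i, i)) [0..<n] = replicate n c"
    by (rule nth_equalityI) auto
  then show ?thesis
    by (subst char_poly_upper_triangular[of _ n])
       (auto simp: diag_mat_def prod_list_replicate)
qed

lemma char_poly_zero_mat: "char_poly (0\<^sub>m n n :: 'a :: comm_ring_1 mat) = [:0, 1:] ^ n"
proof -
  have "0\<^sub>m n n = (0 :: 'a) \<cdot>\<^sub>m 1\<^sub>m n"
    by (rule eq_matI) auto
  then show ?thesis
    by (simp add: char_poly_smult_one_mat)
qed

text \<open>The block matrices \<open>?X\<close> and \<open>?Y\<close> are similar, since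
  \<open>?X * ?P = ?P * ?Y\<close> and \<open>?Q\<close> inverts \<open>?P\<close>. Both are block
  triangular, so their characteristic polynomials factor; the zero blocks supply the powers of the
  indeterminate.\<close>

lemma char_poly_mult_commute:
  fixes A :: "'a :: idom mat"
  assumes A: "A \<in> carrier_mat n m" and B: "B \<in> carrier_mat m n"
  shows "char_poly (A * B) * [:0, 1:] ^ m = [:0, 1:] ^ n * char_poly (B * A)"
proof -
  let ?X = "four_block_mat (A * B) (0\<^sub>m n m) B (0\<^sub>m m m)"
  let ?Y = "four_block_mat (0\<^sub>m n n) (0\<^sub>m n m) B (B * A)"
  let ?P = "four_block_mat (1\<^sub>m n) A (0\<^sub>m m n) (1\<^sub>m m)"
  let ?Q = "four_block_mat (1\<^sub>m n) (- A) (0\<^sub>m m n) (1\<^sub>m m)"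
  have AB: "A * B \<in> carrier_mat n n" and BA: "B * A \<in> carrier_mat m m"
    and A': "- A \<in> carrier_mat n m"
    using A B by auto
  have add_A: "A + - A = 0\<^sub>m n m" "- A + A = 0\<^sub>m n m"
    using A by auto
  have uminus_0: "- 0\<^sub>m m m = (0\<^sub>m m m :: 'a mat)"
    by (rule eq_matI) auto
  have PQ: "?P * ?Q = 1\<^sub>m (n + m)"
    by (subst mult_four_block_mat[OF one_carrier_mat A zero_carrier_mat one_carrier_mat
          one_carrier_mat A' zero_carrier_mat one_carrier_mat])
       (use A A' in \<open>simp_all add: add_A uminus_0\<close>)
  have QP: "?Q * ?P = 1\<^sub>m (n + m)"
    by (subst mult_four_block_mat[OF one_carrier_mat A' zero_carrier_mat one_carrier_mat
          one_carrier_mat A zero_carrier_mat one_carrier_mat])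
       (use A A' in \<open>simp_all add: add_A uminus_0\<close>)
  have PY: "?P * ?Y = four_block_mat (A * B) (A * (B * A)) B (B * A)"
    by (subst mult_four_block_mat[OF one_carrier_mat A zero_carrier_mat one_carrier_mat
          zero_carrier_mat zero_carrier_mat B BA])
       (use A B AB BA in auto)
  have XP: "?X * ?P = four_block_mat (A * B) (A * B * A) B (B * A)"
    by (subst mult_four_block_mat[OF AB zero_carrier_mat B zero_carrier_mat
          one_carrier_mat A zero_carrier_mat one_carrier_mat])
       (use A B AB BA in auto)
  have carrier: "?X \<in> carrier_mat (n + m) (n + m)" "?Y \<in> carrier_mat (n + m) (n + m)"
    "?P \<in> carrier_mat (n + m) (n + m)" "?Q \<in> carrier_mat (n + m) (n + m)"
    using AB BA by auto
  have "?X = ?X * (?P * ?Q)"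
    by (simp only: PQ right_mult_one_mat[OF carrier(1)])
  also have "\<dots> = ?P * ?Y * ?Q"
    using assoc_mult_mat[OF carrier(1,3,4)] assoc_mult_mat[OF A B A] by (simp add: PY XP)
  finally have XY: "?X = ?P * ?Y * ?Q" .
  have "{?X, ?Y, ?P, ?Q} \<subseteq> carrier_mat (n + m) (n + m)"
    using carrier by simp
  from similar_matI[OF this PQ QP XY] have "char_poly ?X = char_poly ?Y"
    by (rule char_poly_similar)
  then show ?thesis
    by (simp only: char_poly_four_block_upper_right_zero[OF AB B zero_carrier_mat]
        char_poly_four_block_upper_right_zero[OF zero_carrier_mat B BA] char_poly_zero_mat)
qed

subsection \<open>Gram matrices\<close>

lemma bipartition_of_orthogonal_representation:
  fixes G :: "'a pair_pre_digraph" and w :: "'a \<Rightarrow> nat \<Rightarrow> real"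
  assumes fin: "finite (pverts G)" and k: "0 < k" "k < card (pverts G)" and c: "c \<noteq> 0"
    and arcs: "\<And>p q. p \<in> pverts G \<Longrightarrow> q \<in> pverts G \<Longrightarrow> p \<noteq> q \<Longrightarrow>
      (p, q) \<in> parcs G \<longleftrightarrow> (\<Sum>t<k. w p t * w q t) \<noteq> 0"
    and frame: "\<And>s t. s < k \<Longrightarrow> t < k \<Longrightarrow>
      (\<Sum>p\<in>pverts G. w p s * w p t) = (if s = t then c else 0)"
  shows "has_multiplicity_bipartition G (card (pverts G) - k) k"
proof -
  define n where "n = card (pverts G)"
  obtain f where f: "bij_betw f {..<n} (pverts G)"
    using ex_bij_betw_nat_finite[OF fin] by (auto simp: n_def atLeast0LessThan)
  have f_in: "f i \<in> pverts G" if "i < n" for i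
    using f that by (auto simp: bij_betw_def)
  have f_neq: "f i \<noteq> f j" if "i < n" "j < n" "i \<noteq> j" for i j
    using f that by (auto simp: bij_betw_def inj_on_def)
  \<comment> \<open>The rows of \<open>U\<close> are the vectors of the vertices, its columns the
    coordinate functions: \<open>arcs\<close> describes the Gram matrix of the rows,
    \<open>frame\<close> that of the columns.\<close>
  define U where "U = mat n k (\<lambda>(i, t). w (f i) t)"
  define A where "A = U * transpose_mat U"
  have U: "U \<in> carrier_mat n k"
    by (simp add: U_def)
  then have A: "A \<in> carrier_mat n n"
    by (simp add: A_def)
  have A_index: "A $$ (i, j) = (\<Sum>t<k. w (f i) t * w (f j) t)" if "i < n" "j < n" for i j
    using that by (simp add: A_def U_def scalar_prod_def atLeast0LessThan)
  have "transpose_mat A = A"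
    by (rule eq_matI) (use A in \<open>auto simp: A_index mult.commute\<close>)
  then have "A \<in> graph_matrices G"
    using A f by (auto simp: graph_matrices_def n_def[symmetric] A_index arcs f_in f_neq)
  have "transpose_mat U * U = c \<cdot>\<^sub>m 1\<^sub>m k"
  proof (rule eq_matI)
    fix s t assume "s < dim_row (c \<cdot>\<^sub>m 1\<^sub>m k)" "t < dim_col (c \<cdot>\<^sub>m 1\<^sub>m k)"
    then show "(transpose_mat U * U) $$ (s, t) = (c \<cdot>\<^sub>m 1\<^sub>m k) $$ (s, t)"
      using sum.reindex_bij_betw[OF f, of "\<lambda>p. w p s * w p t"]
      by (simp add: U_def scalar_prod_def atLeast0LessThan frame)
  qed (simp_all add: U_def)
  then have "char_poly A * [:0, 1:] ^ k = [:0, 1:] ^ n * [:- c, 1:] ^ k"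
    using char_poly_mult_commute[OF U, of "transpose_mat U"] U
    by (simp add: A_def char_poly_smult_one_mat)
  \<comment> \<open>As \<open>k < n\<close>, a factor \<open>[:0, 1:] ^ k\<close> can be split off
    and then cancelled.\<close>
  also have "\<dots> = ([:0, 1:] ^ (n - k) * [:- c, 1:] ^ k) * [:0, 1:] ^ k"
    using k by (simp add: n_def mult_ac flip: power_add)
  finally have char_poly: "char_poly A = [:0, 1:] ^ (n - k) * [:- c, 1:] ^ k"
    by (metis mult_right_cancel pCons_eq_0_iff power_not_zero zero_neq_one)
  \<comment> \<open>Both roots occur because the exponents \<open>n - k\<close> and \<open>k\<close>
    are positive.\<close>
  have "{z. eigenvalue A z} = {0, c}"
    using k eigenvalue_root_char_poly[OF A] by (auto simp: char_poly n_def)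
  moreover have "order z (char_poly A) = order z ([:0, 1:] ^ (n - k)) + order z ([:- c, 1:] ^ k)" for z
    unfolding char_poly by (rule order_mult) simp
  moreover have "order 0 ([:0, 1:] ^ (n - k) :: real poly) = n - k"
    using order_power_n_n[of "0::real"] by simp
  moreover have "order c ([:- c, 1:] ^ k) = k"
    by (rule order_power_n_n)
  moreover have "order 0 ([:- c, 1:] ^ k) = 0" "order c ([:0, 1:] ^ (n - k)) = 0"
    using c by (auto intro!: order_0I)
  ultimately show ?thesis
    unfolding has_multiplicity_bipartition_def
    using \<open>A \<in> graph_matrices G\<close> c n_def
    by (intro bexI[of _ A] exI[of _ 0] exI[of _ c]) auto
qed

subsection \<open>Householder reflections\<close>

text \<open>The entries of I - 2 v v^T / (v^T v), the reflection in the hyperplane orthogonal to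
  \<open>v\<close>.\<close>

definition householder :: "nat \<Rightarrow> (nat \<Rightarrow> real) \<Rightarrow> nat \<Rightarrow> nat \<Rightarrow> real" where
  "householder k v r s = of_bool (r = s) - 2 * v r * v s / (\<Sum>t<k. v t * v t)"

lemma householder_sym: "householder k v r s = householder k v s r"
  by (simp add: householder_def mult_ac eq_commute)

text \<open>Expanding the product of two reflections leaves, besides the identity, only rank-one
  terms; the mixed one carries the inner product of the two directions.\<close>

lemma sum_householder_mult_householder:
  fixes v w :: "nat \<Rightarrow> real"
  assumes "r < k" "s < k"
  shows "(\<Sum>t<k. householder k v t r * householder k w t s) =
    of_bool (r = s) - 2 * v r * v s / (\<Sum>t<k. v t * v t) - 2 * w r * w s / (\<Sum>t<k. w t * w t)
    + 4 * (\<Sum>t<k. v t * w t) * v r * w s / ((\<Sum>t<k. v t * v t) * (\<Sum>t<k. w t * w t))"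
proof -
  define V where "V = (\<Sum>t<k. v t * v t)"
  define W where "W = (\<Sum>t<k. w t * w t)"
  have "(\<Sum>t<k. householder k v t r * householder k w t s) =
    (\<Sum>t<k. (if t = r then of_bool (r = s) else 0) - (if t = s then 2 * v r / V * v t else 0)
      - (if t = r then 2 * w s / W * w t else 0) + 4 * v r * w s / (V * W) * (v t * w t))"
    by (rule sum.cong) (auto simp: householder_def V_def[symmetric] W_def[symmetric] algebra_simps)
  also have "\<dots> = of_bool (r = s) - 2 * v r / V * v s - 2 * w s / W * w r
      + 4 * v r * w s / (V * W) * (\<Sum>t<k. v t * w t)"
    using assms by (simp add: sum.distrib sum_subtractf sum_divide_distrib sum_distrib_left)
  finally show ?thesis
    by (simp add: V_def W_def mult_ac)
qed

text \<open>For equal directions the mixed term cancels the other two rank-one terms.\<close>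

lemma sum_householder_same:
  assumes "r < k" "s < k" "(\<Sum>t<k. v t * v t) \<noteq> 0"
  shows "(\<Sum>t<k. householder k v t r * householder k v t s) = of_bool (r = s)"
  using assms by (simp add: sum_householder_mult_householder)

definition axis :: "real \<Rightarrow> nat \<Rightarrow> real" where
  "axis x t = (if t = 0 then 1 else x)"

lemma sum_axis:
  assumes "0 < k"
  shows "(\<Sum>t<k. axis x t * axis y t) = 1 + (real k - 1) * (x * y)"
proof -
  obtain m where "k = Suc m"
    using assms gr0_conv_Suc by blast
  then show ?thesis
    by (simp add: axis_def sum.lessThan_Suc_shift del: sum.lessThan_Suc)
qed

text \<open>After clearing denominators, a diagonal entry is a number at least 1 minus a small
  multiple of \<open>(x - y)\<^sup>2\<close>. An off-diagonal entry is, up to sign, twice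
  \<open>(x - y) * Z\<close> or twice \<open>(x - y)\<^sup>2\<close>, where \<open>Z\<close> is at
  least 1 because \<open>x\<close> and \<open>y\<close> are nonnegative.\<close>

lemma sum_householder_axis_nonzero:
  assumes "r < k" "s < k" and "0 \<le> x" "0 \<le> y" "x \<noteq> y" and small: "2 * real k * (x - y)\<^sup>2 < 1"
  shows "(\<Sum>t<k. householder k (axis x) t r * householder k (axis y) t s) \<noteq> 0"
proof -
  define m where "m = real k - 1"
  have m: "0 \<le> m"
    using assms by (simp add: m_def)
  define X where "X = 1 + m * (x * x)"
  define Y where "Y = 1 + m * (y * y)"
  define Z where "Z = 1 + m * (x * y)"
  have pos: "1 \<le> X" "1 \<le> Y" "1 \<le> Z"
    using m assms by (simp_all add: X_def Y_def Z_def)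
  \<comment> \<open>\<open>X\<close> and \<open>Y\<close> are the squared norms of the two
    directions, \<open>Z\<close> is their inner product, and \<open>F\<close> is the entry
    multiplied by \<open>X * Y\<close>.\<close>
  define F where "F = of_bool (r = s) * (X * Y) - 2 * axis x r * axis x s * Y
    - 2 * axis y r * axis y s * X + 4 * Z * axis x r * axis y s"
  have "1 \<le> X * Y"
    using mult_mono[OF pos(1,2)] pos by simp
  \<comment> \<open>The second bound serves the diagonal entry at index 0, the first one the other
    diagonal entries.\<close>
  have small': "2 * (x - y)\<^sup>2 < 1" "2 * m * (x - y)\<^sup>2 < 1"
  proof -
    have "1 * (x - y)\<^sup>2 \<le> real k * (x - y)\<^sup>2" "m * (x - y)\<^sup>2 \<le> real k * (x - y)\<^sup>2"
      using assms by (intro mult_right_mono; simp add: m_def)+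
    then show "2 * (x - y)\<^sup>2 < 1" "2 * m * (x - y)\<^sup>2 < 1"
      using small by linarith+
  qed
  have "F \<noteq> 0"
  proof (cases "r = s")
    case True
    then have "F = X * Y - 2 * (if r = 0 then m else 1) * (x - y)\<^sup>2"
      by (simp add: F_def X_def Y_def Z_def axis_def power2_eq_square algebra_simps)
    then show ?thesis
      using small' \<open>1 \<le> X * Y\<close> by (auto split: if_splits)
  next
    case False
    then have "F = 2 * (if r = 0 then (y - x) * Z else if s = 0 then (x - y) * Z else - (x - y)\<^sup>2)"
      by (simp add: F_def X_def Y_def Z_def axis_def power2_eq_square algebra_simps)
    then show ?thesis
      using \<open>x \<noteq> y\<close> pos by auto
  qed
  moreover have "(\<Sum>t<k. householder k (axis x) t r * householder k (axis y) t s) = F / (X * Y)"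
    using assms pos
    by (simp add: sum_householder_mult_householder sum_axis F_def field_simps
        flip: m_def X_def Y_def Z_def)
  ultimately show ?thesis
    using pos by simp
qed

section \<open>Vectors for the vertices of the join\<close>

theorem theorem4p2:
  fixes k l :: nat
    and a :: "nat \<Rightarrow> nat \<Rightarrow> nat"
    and M :: "nat \<Rightarrow> real mat"
    and G :: "(nat \<times> nat \<times> nat) pair_pre_digraph"
  assumes "\<And>i. i \<in> {1..l} \<Longrightarrow> M i \<in> carrier_mat k k"
    and "\<And>i. i \<in> {1..l} \<Longrightarrow> rows_orthogonal (M i)"
    and "\<And>i j r s. i \<in> {1..l} \<Longrightarrow> j \<in> {1..l} \<Longrightarrow> i \<noteq> j \<Longrightarrow> r < k \<Longrightarrow> s < k \<Longrightarrow>
           (transpose_mat (M i) * M j) $$ (r, s) \<noteq> 0"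
    and "\<And>i j. i \<in> {1..k} \<Longrightarrow> j \<in> {1..l} \<Longrightarrow> a i j \<ge> 1"
    and "G = graph_join {1..l} (\<lambda>j. disjoint_union {1..k} (\<lambda>i. complete_graph (a i j)))"
    and "k < card (pverts G)"
  shows "has_multiplicity_bipartition G (card (pverts G) - k) k"
proof -
  have verts: "pverts G = (SIGMA j:{1..l}. SIGMA i:{1..k}. {..<a i j})"
    using assms(5) by (simp add: graph_join_def disjoint_union_def complete_graph_def)
  have arcs: "((j, i, u), (j', i', u')) \<in> parcs G \<longleftrightarrow> (j = j' \<longrightarrow> i = i')"
    if "(j, i, u) \<in> pverts G" "(j', i', u') \<in> pverts G" "(j, i, u) \<noteq> (j', i', u')"
    for j i u j' i' u'
    using that assms(5) by (auto simp: graph_join_def disjoint_union_def complete_graph_def)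
  have fin: "finite (pverts G)"
    by (simp add: verts)
  have "pverts G \<noteq> {}"
    using assms(6) by auto
  then have "0 < k" "0 < l"
    by (auto simp: verts)
  \<comment> \<open>For \<open>j\<close> in \<open>{1..l}\<close> these are distinct points of the
    interval from 0 to 1/(2k), so 2k times the square of a difference is at most 1/(2k) < 1.\<close>
  define x where "x j = real j / (2 * real k * real l)" for j
  define H where "H j = householder k (axis (x j))" for j
  \<comment> \<open>The vector does not depend on \<open>u\<close>: a clique shares one column,
    scaled so that its \<open>a i j\<close> copies together weigh as much as the column once. The
    shift \<open>i - 1\<close> passes to indices from 0.\<close>
  define w where "w = (\<lambda>(j, i, u :: nat) t. H j t (i - 1) / sqrt (real (a i j)))"
  have x: "0 \<le> x j" for j
    by (simp add: x_def)
  have norm: "(\<Sum>t<k. axis (x j) t * axis (x j) t) \<noteq> 0" for j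
  proof -
    have "0 \<le> (real k - 1) * (x j * x j)"
      using \<open>0 < k\<close> by simp
    then show ?thesis
      unfolding sum_axis[OF \<open>0 < k\<close>] by linarith
  qed
  have H_same: "(\<Sum>t<k. H j t r * H j t s) = of_bool (r = s)" if "r < k" "s < k" for j r s
    unfolding H_def using that norm by (rule sum_householder_same)
  have H_diff: "(\<Sum>t<k. H j t r * H j' t s) \<noteq> 0"
    if "r < k" "s < k" "j \<in> {1..l}" "j' \<in> {1..l}" "j \<noteq> j'" for j j' r s
    unfolding H_def
  proof (rule sum_householder_axis_nonzero)
    have "\<bar>x j - x j'\<bar> \<le> real l / (2 * real k * real l)"
      unfolding x_def diff_divide_distrib[symmetric] abs_divide
      by (rule frac_le) (use that \<open>0 < k\<close> \<open>0 < l\<close> in auto)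
    also have "\<dots> = 1 / (2 * real k)"
      using \<open>0 < l\<close> by simp
    finally have "(x j - x j')\<^sup>2 \<le> (1 / (2 * real k))\<^sup>2"
      by (metis abs_ge_zero power2_abs power_mono)
    then have "2 * real k * (x j - x j')\<^sup>2 \<le> 2 * real k * (1 / (2 * real k))\<^sup>2"
      by (rule mult_left_mono) simp
    also have "\<dots> < 1"
      using \<open>0 < k\<close> by (simp add: power2_eq_square field_simps)
    finally show "2 * real k * (x j - x j')\<^sup>2 < 1" .
    show "x j \<noteq> x j'"
      using that \<open>0 < k\<close> \<open>0 < l\<close> by (simp add: x_def)
  qed (use that x in auto)
  have inner: "(\<Sum>t<k. w (j, i, u) t * w (j', i', u') t) =
      (\<Sum>t<k. H j t (i - 1) * H j' t (i' - 1)) / (sqrt (a i j) * sqrt (a i' j'))"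
    for j i u j' i' u'
    by (simp add: w_def sum_divide_distrib)
  show ?thesis
  proof (rule bipartition_of_orthogonal_representation[OF fin \<open>0 < k\<close> assms(6)])
    \<comment> \<open>The frame constant is \<open>real l\<close> because every factor of the join
      contributes one identity matrix.\<close>
    show "real l \<noteq> 0"
      using \<open>0 < l\<close> by simp
  next
    fix p q assume pq: "p \<in> pverts G" "q \<in> pverts G" "p \<noteq> q"
    obtain j i u j' i' u' where [simp]: "p = (j, i, u)" "q = (j', i', u')"
      by (metis prod_cases3)
    have *: "j \<in> {1..l}" "j' \<in> {1..l}" "i - 1 < k" "i' - 1 < k" "1 \<le> i" "1 \<le> i'"
      "0 < a i j" "0 < a i' j'"
      using pq by (auto simp: verts)
    have "(\<Sum>t<k. w p t * w q t) \<noteq> 0 \<longleftrightarrow> (\<Sum>t<k. H j t (i - 1) * H j' t (i' - 1)) \<noteq> 0"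
      using * by (simp add: inner)
    also have "\<dots> \<longleftrightarrow> (j = j' \<longrightarrow> i = i')"
    proof (cases "j = j'")
      case True
      then show ?thesis
        \<comment> \<open>Orthonormality leaves \<open>i - 1 = i' - 1\<close>, which gives
          \<open>i = i'\<close> since both indices are at least 1.\<close>
        using *(3-6) by (simp add: H_same) linarith
    next
      case False
      then show ?thesis
        using H_diff[OF *(3,4,1,2)] by simp
    qed
    finally show "(p, q) \<in> parcs G \<longleftrightarrow> (\<Sum>t<k. w p t * w q t) \<noteq> 0"
      using arcs[of j i u j' i' u'] pq by simp
  next
    fix s t assume st: "s < k" "t < k"
    have "(\<Sum>p\<in>pverts G. w p s * w p t) =
        (\<Sum>j\<in>{1..l}. \<Sum>i\<in>{1..k}. \<Sum>u<a i j. w (j, i, u) s * w (j, i, u) t)"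
      unfolding verts by (simp add: sum.Sigma)
    \<comment> \<open>Each clique has \<open>a i j\<close> equal summands with weight
      1/\<open>a i j\<close>. Symmetry of the reflection turns its columns into rows, so that
      orthonormality of the columns applies to the sum over the cliques.\<close>
    also have "\<dots> = (\<Sum>j\<in>{1..l}. \<Sum>i\<in>{1..k}. H j (i - 1) s * H j (i - 1) t)"
    proof (intro sum.cong refl)
      fix j i assume "j \<in> {1..l}" "i \<in> {1..k}"
      then have "1 \<le> a i j"
        using assms(4) by blast
      then show "(\<Sum>u<a i j. w (j, i, u) s * w (j, i, u) t) = H j (i - 1) s * H j (i - 1) t"
        by (simp add: w_def H_def householder_sym)
    qed
    also have "\<dots> = (\<Sum>j\<in>{1..l}. \<Sum>r<k. H j r s * H j r t)"
      by (simp add: sum.atLeast1_atMost_eq)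
    also have "\<dots> = (if s = t then real l else 0)"
      using st by (simp add: H_same)
    finally show "(\<Sum>p\<in>pverts G. w p s * w p t) = (if s = t then real l else 0)" .
  qed
qed

end
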